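(* Fix any delay $T>0$. Then for every odd integer $n=1,3,5,\dots$ there exists a periodic solution $x_n:\mathbb{R}\to\mathbb{R}$ of the double-well Duffing ordinary differential equation $$\ddot{x}(t)-x(t)+x(t)^3=0$$ with strictly positive energy $H=\tfrac12\dot{x}_n^2-\tfrac12 x_n^2+\tfrac14 x_n^4>0$, with $x_n(0)=A_n>0$, $\dot{x}_n(0)=0$, and with minimal period $p_n=2T/n$. Each of these solutions satisfies $x_n(t-T)=-x_n(t)$ for all $t\in\mathbb{R}$, and is therefore also a periodic solution of the delayed Duffing equation $$\ddot{x}(t)+x(t-T)+x(t)^3=0,\qquad t\in\mathbb{R}.$$ Moreover, the amplitudes $A_n=\max_t|x_n(t)|$ satisfy $A_n>\sqrt{2}$, increase with $n$ (over odd $n$), and are unbounded: $A_n\nearrow\infty$ as $n\to\infty$.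
   Context: The energy $H$ is constant along solutions of the ordinary differential equation. The minimal period of a nonconstant periodic function is its smallest positive period. *)

theory Defs
  imports "HOL-Analysis.Analysis"
begin

text \<open>Since \<open>deriv\<close> is total, the differential equations below carry
  twice differentiability on the whole line as an explicit requirement.\<close>

definition twice_differentiable :: "(real \<Rightarrow> real) \<Rightarrow> bool" where
  "twice_differentiable x \<longleftrightarrow>
     (\<forall>t. x differentiable (at t)) \<and> (\<forall>t. deriv x differentiable (at t))"

definition duffing_solution :: "(real \<Rightarrow> real) \<Rightarrow> bool" where
  "duffing_solution x \<longleftrightarrow>
     twice_differentiable x \<and> (\<forall>t. deriv (deriv x) t - x t + x t ^ 3 = 0)"

definition delayed_duffing_solution :: "real \<Rightarrow> (real \<Rightarrow> real) \<Rightarrow> bool" where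
  "delayed_duffing_solution T x \<longleftrightarrow>
     twice_differentiable x \<and> (\<forall>t. deriv (deriv x) t + x (t - T) + x t ^ 3 = 0)"

definition energy :: "(real \<Rightarrow> real) \<Rightarrow> real \<Rightarrow> real" where
  "energy x t = 1 / 2 * (deriv x t)\<^sup>2 - 1 / 2 * (x t)\<^sup>2 + 1 / 4 * x t ^ 4"

definition is_period :: "(real \<Rightarrow> real) \<Rightarrow> real \<Rightarrow> bool" where
  "is_period x p \<longleftrightarrow> p > 0 \<and> (\<forall>t. x (t + p) = x t)"

text \<open>A constant function has no smallest positive period, so the following
  already forces \<open>x\<close> to be nonconstant.\<close>

definition is_minimal_period :: "(real \<Rightarrow> real) \<Rightarrow> real \<Rightarrow> bool" where
  "is_minimal_period x p \<longleftrightarrow> is_period x p \<and> (\<forall>q. is_period x q \<longrightarrow> p \<le> q)"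

definition is_max_abs :: "(real \<Rightarrow> real) \<Rightarrow> real \<Rightarrow> bool" where
  "is_max_abs x M \<longleftrightarrow> (\<exists>t. \<bar>x t\<bar> = M) \<and> (\<forall>t. \<bar>x t\<bar> \<le> M)"

end

theory Submission
  imports Defs "HOL-Real_Asymp.Real_Asymp"
begin

text \<open>In the polar form \<open>x = A cos \<phi>\<close> the orbit of positive energy with amplitude
  \<open>A > sqrt 2\<close> has a phase with \<open>\<phi>'\<close> an explicit positive function of \<open>\<phi>\<close>; inverting a
  quadrature gives \<open>\<phi>\<close>. When \<open>\<phi>\<close> advances by \<open>pi\<close>, \<open>x\<close> changes sign. The time \<open>P\<close> this takes
  depends continuously and strictly decreasingly on \<open>A\<close>, tends to infinity at the homoclinic
  amplitude \<open>sqrt 2\<close> and to \<open>0\<close> at infinity, so \<open>P = T / n\<close> has a unique solution \<open>A\<^sub>n\<close>, increasing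
  and unbounded in \<open>n\<close>. For odd \<open>n\<close>, shifting by \<open>T = n P\<close> flips the sign, and then
  \<open>- x(t) = x(t - T)\<close> turns the Duffing equation into the delayed one.\<close>

section \<open>Inverting a quadrature\<close>

text \<open>The equation is separable: the antiderivative \<open>F\<close> of \<open>f\<close> gives
  time as a function of phase, and \<open>\<phi>\<close> is its inverse. The lower bound
  \<open>c\<close> makes \<open>F\<close> onto the reals, so the flow is global; periodicity of
  \<open>f\<close> turns a phase shift by \<open>L\<close> into a constant time shift.\<close>

lemma periodic_flow_exists:
  fixes f :: "real \<Rightarrow> real"
  assumes cont: "\<And>u. isCont f u" and c: "c > 0" "\<And>u. f u \<ge> c"
    and per: "\<And>u. f (u + L) = f u" and L: "L \<ge> 0"
  obtains \<phi> where "\<phi> 0 = 0"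
    "\<And>t. (\<phi> has_real_derivative inverse (f (\<phi> t))) (at t)"
    "\<And>t. \<phi> (t + integral {0..L} f) = \<phi> t + L" "strict_mono \<phi>"
proof -
  have "\<exists>F. \<forall>x::real. -\<infinity> < ereal x \<longrightarrow> ereal x < \<infinity> \<longrightarrow> (F has_vector_derivative f x) (at x)"
    by (rule einterval_antiderivative) (use cont in auto)
  then obtain G where G: "\<And>u. (G has_real_derivative f u) (at u)"
    by (auto simp: has_real_derivative_iff_has_vector_derivative)
  define F where "F u = G u - G 0" for u
  have F: "(F has_real_derivative f u) (at u)" for u
    unfolding F_def by (auto intro!: derivative_eq_intros G)
  have F0: "F 0 = 0" by (simp add: F_def)
  have growth: "F v - F u \<ge> c * (v - u)" if "u \<le> v" for u v
  proof (cases "u = v")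
    case False
    with that obtain z where "F v - F u = (v - u) * f z"
      using MVT2[of u v F f] F by auto
    then show ?thesis
      using c(2)[of z] that by (simp add: mult.commute[of "f z"] mult.commute[of c] mult_left_mono)
  qed simp
  have smono: "strict_mono F"
  proof (rule strict_monoI)
    fix u v :: real
    assume "u < v"
    then have "c * (v - u) > 0" using c by simp
    then show "F u < F v" using growth[of u v] \<open>u < v\<close> by linarith
  qed
  have contF: "isCont F u" for u
    using F DERIV_isCont by blast
  have surj: "\<exists>u. F u = t" for t
  proof -
    \<comment> \<open>Since \<open>F\<close> grows at rate at least \<open>c\<close> and vanishes at
      \<open>0\<close>, it takes the value \<open>t\<close> within distance
      \<open>\<bar>t\<bar> / c\<close> of \<open>0\<close>.\<close>
    define r where "r = \<bar>t\<bar> / c"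
    have r: "r \<ge> 0" "c * r = \<bar>t\<bar>" using c by (auto simp: r_def)
    have "F (-r) \<le> t" "t \<le> F r"
      using growth[of "-r" 0] growth[of 0 r] r F0 by auto
    then show ?thesis
      using IVT[of F "-r" t r] contF r by auto
  qed
  define \<phi> where "\<phi> = inv F"
  have F\<phi>: "F (\<phi> t) = t" for t
    unfolding \<phi>_def using surj by (metis surj_def surj_f_inv_f)
  have \<phi>F: "\<phi> (F u) = u" for u
    unfolding \<phi>_def using smono by (simp add: strict_mono_imp_inj_on)
  have cont\<phi>: "isCont \<phi> t" for t
    using isCont_inverse_function[of 1 "\<phi> t" \<phi> F] \<phi>F contF F\<phi> by auto
  show ?thesis
  proof
    show "\<phi> 0 = 0" using \<phi>F[of 0] F0 by simp
    show "(\<phi> has_real_derivative inverse (f (\<phi> t))) (at t)" for t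
    proof (rule DERIV_inverse_function[where f = F and a = "t - 1" and b = "t + 1"])
      show "f (\<phi> t) \<noteq> 0" using c(1) c(2)[of "\<phi> t"] by linarith
    qed (use F F\<phi> cont\<phi> in auto)
    show "strict_mono \<phi>"
      by (rule strict_monoI) (metis F\<phi> smono strict_mono_less)
    have I: "integral {0..L} f = F L"
    proof -
      have "(f has_integral F L - F 0) {0..L}"
        using L by (intro fundamental_theorem_of_calculus)
          (auto simp: has_real_derivative_iff_has_vector_derivative[symmetric]
                intro: has_field_derivative_at_within F)
      then show ?thesis using F0 by (simp add: integral_unique)
    qed
    have shift: "F (u + L) = F u + F L" for u
    proof -
      have "((\<lambda>u. F (u + L) - F u) has_real_derivative 0) (at u)" for u
        using F[of "u + L"] F[of u] per[of u]
        by (auto intro!: derivative_eq_intros simp: DERIV_shift)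
      then have "F (u + L) - F u = F (0 + L) - F 0"
        by (intro DERIV_isconst_all[of "\<lambda>u. F (u + L) - F u"]) auto
      then show ?thesis using F0 by simp
    qed
    show "\<phi> (t + integral {0..L} f) = \<phi> t + L" for t
      using \<phi>F[of "\<phi> t + L"] by (simp add: I shift F\<phi>)
  qed
qed

section \<open>The half period as a function of the amplitude\<close>

text \<open>With \<open>a = A\<^sup>2 / 2\<close> for the amplitude \<open>A\<close>, energy conservation for \<open>x = A cos \<phi>\<close>
  reads \<open>\<phi>' = 1 / slowness a \<phi>\<close>, so a half turn of \<open>\<phi>\<close> takes the time \<open>half_period a\<close>.\<close>

definition slowness :: "real \<Rightarrow> real \<Rightarrow> real" where
  "slowness a u = 1 / sqrt (a * (1 + (cos u)\<^sup>2) - 1)"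

definition half_period :: "real \<Rightarrow> real" where
  "half_period a = integral {0..pi} (slowness a)"

lemma slowness_radicand_bounds:
  fixes a u :: real
  assumes "a > 1"
  shows "a * (1 + (cos u)\<^sup>2) - 1 \<ge> a - 1" "a * (1 + (cos u)\<^sup>2) - 1 \<le> 2 * a - 1"
    "a * (1 + (cos u)\<^sup>2) - 1 > 0"
proof -
  have "(cos u)\<^sup>2 \<le> 1" using sin_cos_squared_add[of u] zero_le_power2[of "sin u"] by linarith
  then have "a * (cos u)\<^sup>2 \<le> a * 1" using assms by (intro mult_left_mono) auto
  moreover have "a * (cos u)\<^sup>2 \<ge> 0" using assms by simp
  ultimately show "a * (1 + (cos u)\<^sup>2) - 1 \<ge> a - 1" "a * (1 + (cos u)\<^sup>2) - 1 \<le> 2 * a - 1"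
    "a * (1 + (cos u)\<^sup>2) - 1 > 0"
    using assms unfolding distrib_left by linarith+
qed

lemma slowness_pos: "a > 1 \<Longrightarrow> slowness a u > 0"
  using slowness_radicand_bounds[of a u] by (simp add: slowness_def)

lemma isCont_slowness: "a > 1 \<Longrightarrow> isCont (slowness a) u"
  using slowness_radicand_bounds(3)[of a u] unfolding slowness_def
  by (intro continuous_intros) auto

lemma slowness_ge: "a > 1 \<Longrightarrow> slowness a u \<ge> 1 / sqrt (2 * a - 1)"
  using slowness_radicand_bounds[of a u] unfolding slowness_def
  by (intro divide_left_mono) auto

lemma slowness_le: "a > 1 \<Longrightarrow> slowness a u \<le> 1 / sqrt (a - 1)"
  using slowness_radicand_bounds[of a u] unfolding slowness_def
  by (intro divide_left_mono) auto

lemma slowness_integrable: "a > 1 \<Longrightarrow> slowness a integrable_on {b..c}"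
  by (intro integrable_continuous_real continuous_at_imp_continuous_on) (auto intro: isCont_slowness)

lemma half_period_strict_antimono:
  assumes "a > 1" "a < b"
  shows "half_period b < half_period a"
  unfolding half_period_def
proof (rule integral_less_real)
  show "continuous_on {0..pi} (slowness b)" "continuous_on {0..pi} (slowness a)"
    using assms by (auto intro!: continuous_at_imp_continuous_on isCont_slowness)
  fix u
  have "a * (1 + (cos u)\<^sup>2) < b * (1 + (cos u)\<^sup>2)"
    using assms by (intro mult_strict_right_mono) (auto simp: add_pos_nonneg)
  then show "slowness b u < slowness a u"
    using slowness_radicand_bounds(3)[of a u] assms unfolding slowness_def
    by (intro divide_strict_left_mono) auto
qed (simp_all add: not_le)

lemma half_period_le: "a > 1 \<Longrightarrow> half_period a \<le> pi / sqrt (a - 1)"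
  using integral_le[OF slowness_integrable integrable_const_ivl, of a 0 pi "1 / sqrt (a - 1)"]
    slowness_le[of a]
  by (simp add: half_period_def)

lemma half_period_pos:
  assumes "a > 1"
  shows "half_period a > 0"
proof -
  have "0 < pi / sqrt (2 * a - 1)" using assms by simp
  also have "\<dots> \<le> half_period a"
    using integral_le[OF integrable_const_ivl[of "1 / sqrt (2 * a - 1)" 0 pi] slowness_integrable]
      slowness_ge[of a] assms by (simp add: half_period_def)
  finally show ?thesis .
qed

lemma continuous_on_half_period: "continuous_on {1<..} half_period"
proof -
  have "continuous_on ({1<..} \<times> cbox 0 pi) (\<lambda>(a, u). slowness a u)"
    unfolding slowness_def split_def
    by (intro continuous_intros ballI)
      (use slowness_radicand_bounds(3) in \<open>force dest: less_imp_neq\<close>)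
  from integral_continuous_on_param[OF this] show ?thesis
    unfolding half_period_def by simp
qed

text \<open>Since \<open>\<bar>cos (pi / 2 + v)\<bar> \<le> v\<close> for \<open>v \<ge> 0\<close>, the integrand exceeds
  \<open>1 / (2 v + e)\<close> at distance \<open>v\<close> past \<open>pi / 2\<close>, which accounts for the logarithm.\<close>

lemma half_period_ge:
  assumes "0 < e" "e \<le> 1"
  shows "half_period (1 + e\<^sup>2) \<ge> ln (1 / e) / 2"
proof -
  define a where "a = 1 + e\<^sup>2"
  have a: "a > 1" "a \<le> 2" using assms by (auto simp: a_def power_le_one)
  define g where "g u = 1 / (2 * (u - pi / 2) + e)" for u
  define G where "G u = ln (2 * (u - pi / 2) + e) / 2" for u
  have "(g has_integral G pi - G (pi / 2)) {pi/2..pi}"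
  proof (rule fundamental_theorem_of_calculus)
    fix u assume "u \<in> {pi/2..pi}"
    then have "2 * (u - pi / 2) + e > 0" using assms by auto
    then show "(G has_vector_derivative g u) (at u within {pi/2..pi})"
      unfolding G_def g_def has_real_derivative_iff_has_vector_derivative[symmetric]
      by (auto intro!: derivative_eq_intros simp: divide_simps)
  qed auto
  \<comment> \<open>The upper endpoint contributes \<open>ln (pi + e) / 2\<close>, which is
    nonnegative and is dropped.\<close>
  moreover have "ln (1 / e) / 2 \<le> G pi - G (pi / 2)"
  proof -
    have "ln (pi + e) \<ge> ln 1"
      using assms pi_gt3 by (subst ln_le_cancel_iff) linarith+
    then show ?thesis using assms by (simp add: G_def ln_div)
  qed
  moreover have "G pi - G (pi / 2) \<le> integral {pi/2..pi} (slowness a)"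
  proof (rule has_integral_le[OF calculation(1) integrable_integral[OF slowness_integrable[OF a(1)]]])
    fix u assume u: "u \<in> {pi/2..pi}"
    define v where "v = u - pi / 2"
    have v: "v \<ge> 0" using u by (simp add: v_def)
    have "cos u = - sin v"
      by (simp add: v_def sin_diff)
    then have "\<bar>cos u\<bar> \<le> \<bar>v\<bar>"
      using abs_sin_x_le_abs_x[of v] by simp
    then have c2: "(cos u)\<^sup>2 \<le> v\<^sup>2"
      by (simp add: abs_le_square_iff)
    \<comment> \<open>The distance of \<open>a\<close> from the homoclinic value \<open>1\<close> is
      a square, so the radicand compares with the square of a linear function of \<open>v\<close>.
      The factor \<open>2\<close> comes from \<open>a \<le> 2\<close>, where
      \<open>e \<le> 1\<close> enters.\<close>
    have "a * (1 + (cos u)\<^sup>2) - 1 = e\<^sup>2 + a * (cos u)\<^sup>2"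
      by (simp add: a_def algebra_simps)
    also have "a * (cos u)\<^sup>2 \<le> 2 * v\<^sup>2"
      using c2 a by (intro mult_mono) auto
    also have "e\<^sup>2 + 2 * v\<^sup>2 \<le> (2 * v + e)\<^sup>2"
      using v assms by (simp add: power2_eq_square algebra_simps)
    finally have "sqrt (a * (1 + (cos u)\<^sup>2) - 1) \<le> 2 * v + e"
      using v assms by (intro real_le_lsqrt) auto
    then show "g u \<le> slowness a u"
      unfolding g_def slowness_def v_def[symmetric]
      using slowness_radicand_bounds(3)[OF a(1), of u] v assms by (intro divide_left_mono) auto
  qed
  moreover have "integral {pi/2..pi} (slowness a) \<le> half_period a"
    unfolding half_period_def using a slowness_pos[OF a(1)]
    by (intro integral_subset_le slowness_integrable) (auto intro: less_imp_le)
  ultimately show ?thesis by (simp add: a_def)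
qed

lemma half_period_surj:
  assumes "\<tau> > 0"
  obtains a where "a > 1" "half_period a = \<tau>"
proof -
  \<comment> \<open>Solves \<open>ln (1 / e) / 2 = \<tau>\<close>, so that the half period at
    \<open>l\<close> is at least \<open>\<tau>\<close>.\<close>
  define e where "e = exp (- (2 * \<tau>))"
  define l where "l = 1 + e\<^sup>2"
  \<comment> \<open>The square makes \<open>pi / sqrt (r - 1)\<close> at most \<open>\<tau>\<close>;
    the summand \<open>l\<close> keeps \<open>r\<close> to the right of \<open>l\<close>.\<close>
  define r where "r = l + 1 + (pi / \<tau>)\<^sup>2"
  have e: "0 < e" "e \<le> 1" using assms by (auto simp: e_def)
  have l: "l > 1" using e by (simp add: l_def)
  have "half_period l \<ge> \<tau>"
    using half_period_ge[OF e] by (simp add: l_def e_def ln_div)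
  moreover have lr: "l \<le> r" by (simp add: r_def)
  moreover have "half_period r \<le> \<tau>"
  proof -
    have "(pi / \<tau>)\<^sup>2 \<le> r - 1" using l by (simp add: r_def)
    then have "pi / \<tau> \<le> sqrt (r - 1)" using assms by (simp add: real_le_rsqrt)
    then have "pi / sqrt (r - 1) \<le> \<tau>"
      using assms l lr by (simp add: field_simps)
    then show ?thesis using half_period_le[of r] l lr by simp
  qed
  moreover have "continuous_on {l..r} half_period"
    by (rule continuous_on_subset[OF continuous_on_half_period]) (use l in auto)
  ultimately obtain a where "l \<le> a" "a \<le> r" "half_period a = \<tau>"
    using IVT2'[of half_period r \<tau> l] by auto
  then show ?thesis using that[of a] l by simp
qed

section \<open>The orbit of a given amplitude\<close>

text \<open>The bound on \<open>A\<close> means \<open>a > 1\<close>, so the phase speed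
  \<open>g\<close> never vanishes and the orbit circles both wells. The sign change, the maximum and
  the minimal period are then read off from the phase.\<close>

lemma duffing_orbit_exists:
  assumes "A > sqrt 2"
  defines "P \<equiv> half_period (A\<^sup>2 / 2)"
  obtains x where "duffing_solution x" "\<And>t. energy x t > 0" "x 0 = A" "deriv x 0 = 0"
    "is_minimal_period x (2 * P)" "\<And>t. x (t + P) = - x t" "is_max_abs x A"
proof -
  define a where "a = A\<^sup>2 / 2"
  have A: "A > 0" using assms less_trans[of 0 "sqrt 2" A] by simp
  have "(sqrt 2)\<^sup>2 < A\<^sup>2" using assms by (intro power_strict_mono) auto
  then have a: "a > 1" by (simp add: a_def)
  have Ppos: "P > 0" using half_period_pos[OF a] by (simp add: P_def a_def)
  define g where "g u = sqrt (a * (1 + (cos u)\<^sup>2) - 1)" for u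
  have g: "inverse (slowness a u) = g u" for u
    by (simp add: slowness_def g_def)
  have gpos: "g u > 0" and g2: "(g u)\<^sup>2 = a * (1 + (cos u)\<^sup>2) - 1" for u
    using slowness_radicand_bounds(3)[OF a, of u] by (auto simp: g_def)
  obtain \<phi> where \<phi>0: "\<phi> 0 = 0" and d\<phi>: "\<And>t. (\<phi> has_real_derivative g (\<phi> t)) (at t)"
    and shift: "\<And>t. \<phi> (t + P) = \<phi> t + pi" and smono: "strict_mono \<phi>"
  proof (rule periodic_flow_exists[of "slowness a" "1 / sqrt (2 * a - 1)" pi])
    \<comment> \<open>Only the square of the cosine enters, so a half turn is already a
      period.\<close>
    show "slowness a (u + pi) = slowness a u" for u by (simp add: slowness_def)
    show "isCont (slowness a) u" "slowness a u \<ge> 1 / sqrt (2 * a - 1)" for u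
      using a isCont_slowness slowness_ge by auto
  qed (use a that in \<open>auto simp: g P_def half_period_def simp flip: a_def\<close>)
  define x where "x t = A * cos (\<phi> t)" for t
  define y where "y t = - A * sin (\<phi> t) * g (\<phi> t)" for t
  have dx: "(x has_real_derivative y t) (at t)" for t
    unfolding x_def y_def by (auto intro!: derivative_eq_intros d\<phi>)
  have dg: "(g has_real_derivative - a * cos u * sin u / g u) (at u)" for u
    using slowness_radicand_bounds(3)[OF a, of u] unfolding g_def
    by (auto intro!: derivative_eq_intros simp: field_simps)
  have dy: "(y has_real_derivative x t - x t ^ 3) (at t)" for t
  proof -
    let ?c = "cos (\<phi> t)" and ?s = "sin (\<phi> t)" and ?g = "g (\<phi> t)"
    \<comment> \<open>The phase speed from the chain rule cancels the denominator in the derivative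
      of \<open>g\<close>; in \<open>y'\<close> only \<open>g\<^sup>2\<close> survives, a polynomial
      in the cosine.\<close>
    have "((\<lambda>t. g (\<phi> t)) has_real_derivative - a * ?c * ?s) (at t)"
      using DERIV_chain2[OF dg d\<phi>, of t] gpos[of "\<phi> t"] by simp
    then have "(y has_real_derivative - A * (?c * ?g) * ?g - A * ?s * (- a * ?c * ?s)) (at t)"
      unfolding y_def by (auto intro!: derivative_eq_intros d\<phi>)
    also have "- A * (?c * ?g) * ?g - A * ?s * (- a * ?c * ?s)
        = A * ?c * (a * ?s\<^sup>2 - ?g\<^sup>2)"
      by (simp add: power2_eq_square algebra_simps)
    also have "a * ?s\<^sup>2 - ?g\<^sup>2 = 1 - A\<^sup>2 * ?c\<^sup>2"
      unfolding g2 sin_squared_eq a_def by (simp add: field_simps)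
    finally show ?thesis
      by (simp add: x_def power2_eq_square power3_eq_cube algebra_simps)
  qed
  have deriv_x: "deriv x = y" using dx by (auto intro: DERIV_imp_deriv)
  have deriv_y: "deriv y t = x t - x t ^ 3" for t using dy by (auto intro: DERIV_imp_deriv)
  show ?thesis
  proof
    show "duffing_solution x"
      unfolding duffing_solution_def twice_differentiable_def deriv_x deriv_y
      using dx dy by (auto simp: real_differentiable_def)
    show "energy x t > 0" for t
    proof -
      let ?c = "cos (\<phi> t)"
      have "(y t)\<^sup>2 = 2 * a * (1 - ?c\<^sup>2) * (a * (1 + ?c\<^sup>2) - 1)"
        unfolding y_def power_mult_distrib g2 sin_squared_eq by (simp add: a_def)
      moreover have "x t ^ 4 = (2 * a)\<^sup>2 * (?c\<^sup>2)\<^sup>2" "(x t)\<^sup>2 = 2 * a * ?c\<^sup>2"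
        unfolding x_def a_def by (simp_all add: power_mult_distrib flip: power_mult)
      \<comment> \<open>This is the energy at the turning point \<open>x = A\<close> with zero
        velocity.\<close>
      ultimately have "energy x t = a * (a - 1)"
        by (simp add: energy_def deriv_x power2_eq_square algebra_simps)
      then show ?thesis using a by simp
    qed
    show "x 0 = A" "deriv x 0 = 0" by (simp_all add: deriv_x x_def y_def \<phi>0)
    show anti: "x (t + P) = - x t" for t by (simp add: x_def shift)
    show "is_max_abs x A"
      unfolding is_max_abs_def
    proof (intro conjI exI[of _ 0] allI)
      show "\<bar>x 0\<bar> = A" using A by (simp add: x_def \<phi>0)
      show "\<bar>x t\<bar> \<le> A" for t
        using A mult_left_mono[OF abs_cos_le_one[of "\<phi> t"], of A] by (simp add: x_def abs_mult)
    qed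
    show "is_minimal_period x (2 * P)"
      unfolding is_minimal_period_def
    proof (intro conjI allI impI)
      have "x (t + 2 * P) = x t" for t
        using anti[of t] anti[of "t + P"] by (simp add: algebra_simps)
      then show "is_period x (2 * P)" using Ppos by (simp add: is_period_def)
      fix q assume q: "is_period x q"
      show "2 * P \<le> q"
      proof (rule ccontr)
        assume "\<not> 2 * P \<le> q"
        \<comment> \<open>The value \<open>A\<close> is attained only at phases in
          \<open>2 * pi * k\<close>, and a period below \<open>2 * P\<close> would end at a phase
          strictly between \<open>0\<close> and \<open>2 * pi\<close>.\<close>
        have "q > 0" "x (0 + q) = x 0" using q unfolding is_period_def by blast+
        then have "cos (\<phi> q) = 1" using A \<phi>0 by (simp add: x_def)
        then obtain k :: int where k: "\<phi> q = k * 2 * pi" by (auto simp: cos_one_2pi_int)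
        have "\<phi> 0 < \<phi> q" "\<phi> q < \<phi> (2 * P)"
          using \<open>q > 0\<close> \<open>\<not> 2 * P \<le> q\<close> smono by (auto simp: strict_mono_less)
        moreover have "\<phi> (2 * P) = 2 * pi"
          using shift[of 0] shift[of P] \<phi>0 by simp
        ultimately have "0 < real_of_int k" "real_of_int k < 1"
          using k \<phi>0 by (auto simp: zero_less_mult_iff)
        then show False by auto
      qed
    qed
  qed
qed

section \<open>From half periods to the delay\<close>

text \<open>Each shift by \<open>P\<close> contributes a factor \<open>-1\<close>. With
  \<open>P = T / n\<close> the total shift is the delay \<open>T\<close>.\<close>

lemma shift_odd_multiple:
  fixes x :: "real \<Rightarrow> real"
  assumes anti: "\<And>t. x (t + P) = - x t" and "odd n"
  shows "x (t - real n * P) = - x t"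
proof -
  have "x (s + real k * P) = (-1) ^ k * x s" for k s
  proof (induction k)
    case (Suc k)
    then show ?case using anti[of "s + real k * P"] by (simp add: algebra_simps)
  qed simp
  from this[of "t - real n * P" n] show ?thesis using \<open>odd n\<close> by simp
qed

theorem mainTheorem3:
  fixes T :: real
  assumes "T > 0"
  shows "\<exists>(x :: nat \<Rightarrow> real \<Rightarrow> real) (A :: nat \<Rightarrow> real).
    (\<forall>n. odd n \<longrightarrow>
        duffing_solution (x n) \<and>
        (\<forall>t. energy (x n) t > 0) \<and>
        x n 0 = A n \<and> A n > 0 \<and>
        deriv (x n) 0 = 0 \<and>
        is_minimal_period (x n) (2 * T / real n) \<and>
        (\<forall>t. x n (t - T) = - x n t) \<and>
        delayed_duffing_solution T (x n) \<and>
        is_max_abs (x n) (A n) \<and>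
        A n > sqrt 2) \<and>
    (\<forall>m n. odd m \<and> odd n \<and> m < n \<longrightarrow> A m < A n) \<and>
    filterlim (\<lambda>k. A (2 * k + 1)) at_top sequentially"
proof -
  have "\<exists>A > sqrt 2. half_period (A\<^sup>2 / 2) = T / real n" if "odd n" for n
  proof -
    have "T / real n > 0" using assms odd_pos[OF that] by simp
    then obtain a where a: "a > 1" "half_period a = T / real n" by (rule half_period_surj)
    then show ?thesis by (intro exI[of _ "sqrt (2 * a)"]) auto
  qed
  \<comment> \<open>For even \<open>n\<close> the chosen values are arbitrary, so all claims about
    \<open>A\<close> are restricted to odd indices.\<close>
  then obtain A where A: "\<And>n. odd n \<Longrightarrow> A n > sqrt 2"
    and PA: "\<And>n. odd n \<Longrightarrow> half_period ((A n)\<^sup>2 / 2) = T / real n"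
    by metis
  have "\<exists>x. duffing_solution x \<and> (\<forall>t. energy x t > 0) \<and> x 0 = A n \<and> deriv x 0 = 0 \<and>
      is_minimal_period x (2 * T / real n) \<and> (\<forall>t. x (t + T / real n) = - x t) \<and>
      is_max_abs x (A n)" if "odd n" for n
    by (rule duffing_orbit_exists[OF A[OF that]]) (auto simp: PA[OF that])
  then obtain x where x: "\<And>n. odd n \<Longrightarrow> duffing_solution (x n) \<and> (\<forall>t. energy (x n) t > 0) \<and>
      x n 0 = A n \<and> deriv (x n) 0 = 0 \<and> is_minimal_period (x n) (2 * T / real n) \<and>
      (\<forall>t. x n (t + T / real n) = - x n t) \<and> is_max_abs (x n) (A n)"
    by metis
  \<comment> \<open>Strict decrease of \<open>half_period\<close> turns comparisons of half periods
    into comparisons of amplitudes. Taking \<open>B = A m\<close> gives monotonicity in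
    \<open>n\<close>; taking \<open>B\<close> as an arbitrary level gives divergence.\<close>
  have less: "B < A n" if "odd n" "B > sqrt 2" "T / real n < half_period (B\<^sup>2 / 2)" for B n
  proof (rule ccontr)
    assume "\<not> B < A n"
    then have le: "(A n)\<^sup>2 / 2 \<le> B\<^sup>2 / 2"
      using A[OF that(1)] by (intro divide_right_mono power_mono) (auto intro: order_trans[of 0 "sqrt 2"])
    have "(sqrt 2)\<^sup>2 < (A n)\<^sup>2" using A[OF that(1)] by (intro power_strict_mono) auto
    then have "half_period (B\<^sup>2 / 2) \<le> T / real n"
      using le half_period_strict_antimono[of "(A n)\<^sup>2 / 2" "B\<^sup>2 / 2"] PA[OF that(1)]
      by (cases "(A n)\<^sup>2 = B\<^sup>2") auto
    with that show False by simp
  qed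
  show ?thesis
  proof (intro exI[of _ x] exI[of _ A] conjI allI impI)
    fix n :: nat assume n: "odd n"
    show anti: "x n (t - T) = - x n t" for t
      using shift_odd_multiple[of "x n" "T / real n" n t] x[OF n] n odd_pos[OF n] by simp
    show "delayed_duffing_solution T (x n)"
      using x[OF n] by (simp add: duffing_solution_def delayed_duffing_solution_def anti)
    show "A n > 0" using A[OF n] less_trans[of 0 "sqrt 2" "A n"] by simp
  next
    fix m n :: nat assume mn: "odd m \<and> odd n \<and> m < n"
    then have "T / real n < T / real m"
      using assms odd_pos[of m] by (intro divide_strict_left_mono) auto
    then show "A m < A n" using mn less[of n "A m"] A[of m] PA[of m] by simp
  next
    show "filterlim (\<lambda>k. A (2 * k + 1)) at_top sequentially"
      unfolding filterlim_at_top
    proof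
      fix Z :: real
      \<comment> \<open>Raising the level to at least \<open>2\<close> puts it above the homoclinic
        amplitude, where its half period is positive; \<open>T / n\<close> eventually drops below
        that.\<close>
      define B where "B = max Z 2"
      have B: "B > sqrt 2" using real_less_lsqrt[of 2 2] by (auto simp: B_def less_max_iff_disj)
      then have "(sqrt 2)\<^sup>2 < B\<^sup>2" by (intro power_strict_mono) auto
      then have "half_period (B\<^sup>2 / 2) > 0" by (intro half_period_pos) simp
      moreover have "(\<lambda>k. T / real (2 * k + 1)) \<longlonglongrightarrow> 0"
        by real_asymp
      ultimately have "\<forall>\<^sub>F k in sequentially. T / real (2 * k + 1) < half_period (B\<^sup>2 / 2)"
        by (rule order_tendstoD(2)[rotated])
      then show "\<forall>\<^sub>F k in sequentially. Z \<le> A (2 * k + 1)"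
      proof eventually_elim
        case (elim k)
        then have "B < A (2 * k + 1)" using B by (intro less) auto
        then show ?case by (simp add: B_def)
      qed
    qed
  qed (use x A in auto)
qed

end
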